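(* Let $X\in\mathbb{R}^{m\times N}$, let $\widetilde X\in\mathbb{R}^{m\times N}$ have full column rank, let $w\in\mathbb{R}^N$, $\delta>0$ and $p>0$. Run Qronos (with $\lambda=0$) with the stochastic rounding operator $\mathcal{Q}_{\mathrm{stoc}}$ and the infinite alphabet $\mathcal{A}^\delta$ on $w$ using $X$ and $\widetilde X$, obtaining $q$. Then $$\max_i\big|(Xw-\widetilde Xq)_i\big|\le\max_i\Big|\big(P_{\widetilde X_{\ge2}^{\perp}}P_{\widetilde X_1^{\perp}}(Xw-\widetilde Xw)\big)_i\Big|+\delta\sqrt{2\pi p\log N}\,\max_j\|P_{\widetilde X_{\ge j+1}^{\perp}}\widetilde X_j\|_2$$ with probability greater than $1-\frac{\sqrt2\,m}{N^p}$.
   Context: Notation: for a matrix $A$ with columns $A_1,\dots,A_n$, $A_{\ge j}=(A_j,\dots,A_n)$; $P_{A^\perp}=I-AA^\dagger$ is the orthogonal projection onto the orthogonal complement of the column space of $A$ (equal to $I$ if $A$ has no columns). For a vector $v$, $v_{\ge j}=(v_j,\dots,v_n)^\top$. Stochastic quantizer: for $\mathcal{A}^\delta=\{k\delta:k\in\mathbb{Z}\}$, $\mathcal{Q}_{\mathrm{stoc}}(z)$ equals $\lfloor z/\delta\rfloor\delta$ with probability $1-\frac z\delta+\lfloor\frac z\delta\rfloor$ and $(\lfloor z/\delta\rfloor+1)\delta$ otherwise, so $\mathbb{E}[\mathcal{Q}_{\mathrm{stoc}}(z)]=z$; each call uses fresh randomness independent of the past. Qronos with $\lambda=0$ and stochastic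 rounding, applied to $w\in\mathbb{R}^N$ with data $X,\widetilde X$: let $(\widetilde X^\top\widetilde X)^{-1}=LL^\top$ be the Cholesky decomposition ($L$ lower triangular). Set $w^{(0)}=w$, $q_1=\mathcal{Q}_{\mathrm{stoc}}\big(\widetilde X_1^\top(Xw-\widetilde X_{\ge2}w_{\ge2})/\|\widetilde X_1\|_2^2\big)$, and $w^{(1)}_{\ge2}=\widetilde X_{\ge2}^{\dagger}(Xw-q_1\widetilde X_1)$. For $t=2,\dots,N$: $q_t=\mathcal{Q}_{\mathrm{stoc}}(w^{(t-1)}_t)$ and $w^{(t)}_{\ge t+1}=w^{(t-1)}_{\ge t+1}-L_{\ge t+1,t}\,(w^{(t-1)}_t-q_t)/L_{tt}$. The output is $q=(q_1,\dots,q_N)^\top$. *)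

theory Defs
  imports
    "HOL-Probability.Probability"
    "Jordan_Normal_Form.Gauss_Jordan_Elimination"
    "Jordan_Normal_Form.DL_Rank"
begin

unbundle no vec_syntax and no inner_syntax
hide_const (open) Finite_Cartesian_Product.vec Finite_Cartesian_Product.mat
hide_const (open) Finite_Cartesian_Product.row Finite_Cartesian_Product.column

text \<open>Matrices and vectors are indexed from 0: the column written $A_j$ on paper is
  \<open>col A (j - 1)\<close>, and $A_{\ge j}$ is \<open>cols_from A (j - 1)\<close>.\<close>

definition norm2 :: "real vec \<Rightarrow> real" where
  "norm2 v = sqrt (v \<bullet> v)"

definition cols_from :: "real mat \<Rightarrow> nat \<Rightarrow> real mat" where
  "cols_from A j = mat (dim_row A) (dim_col A - j) (\<lambda>(i, k). A $$ (i, j + k))"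

definition vec_from :: "real vec \<Rightarrow> nat \<Rightarrow> real vec" where
  "vec_from v j = vec (dim_vec v - j) (\<lambda>k. v $ (j + k))"

definition col_mat :: "real mat \<Rightarrow> nat \<Rightarrow> real mat" where
  "col_mat A j = mat_of_cols (dim_row A) [col A j]"

text \<open>The four Penrose conditions; they determine the pseudoinverse uniquely.\<close>

definition is_pseudoinverse :: "real mat \<Rightarrow> real mat \<Rightarrow> bool" where
  "is_pseudoinverse A B \<longleftrightarrow>
     B \<in> carrier_mat (dim_col A) (dim_row A) \<and>
     A * B * A = A \<and> B * A * B = B \<and>
     transpose_mat (A * B) = A * B \<and> transpose_mat (B * A) = B * A"

definition pinv :: "real mat \<Rightarrow> real mat" where
  "pinv A = (THE B. is_pseudoinverse A B)"

text \<open>For a matrix without columns, \<open>A * pinv A\<close> is the zero matrix, so \<open>proj_perp A\<close> is the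
  identity.\<close>

definition proj_perp :: "real mat \<Rightarrow> real mat" where
  "proj_perp A = 1\<^sub>m (dim_row A) - A * pinv A"

text \<open>With a positive diagonal, the Cholesky factor of a positive definite matrix is unique.\<close>

definition is_cholesky_factor :: "real mat \<Rightarrow> real mat \<Rightarrow> bool" where
  "is_cholesky_factor M L \<longleftrightarrow>
     L \<in> carrier_mat (dim_row M) (dim_row M) \<and>
     (\<forall>i < dim_row M. \<forall>j < dim_row M. i < j \<longrightarrow> L $$ (i, j) = 0) \<and>
     (\<forall>i < dim_row M. 0 < L $$ (i, i)) \<and>
     M = L * transpose_mat L"

definition cholesky_factor :: "real mat \<Rightarrow> real mat" where
  "cholesky_factor M = (THE L. is_cholesky_factor M L)"

definition q_stoc :: "real \<Rightarrow> real \<Rightarrow> real pmf" where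
  "q_stoc \<delta> z =
     map_pmf (\<lambda>b. if b then of_int \<lfloor>z / \<delta>\<rfloor> * \<delta> else (of_int \<lfloor>z / \<delta>\<rfloor> + 1) * \<delta>)
       (bernoulli_pmf (1 - z / \<delta> + of_int \<lfloor>z / \<delta>\<rfloor>))"

text \<open>The state after step $t$ of Qronos is the vector
  $(q_1,\dots,q_t,w^{(t)}_{t+1},\dots,w^{(t)}_N)$; the monadic bind of probability mass functions
  gives each call of the quantizer fresh randomness.\<close>

definition qronos_first :: "real \<Rightarrow> real mat \<Rightarrow> real mat \<Rightarrow> real vec \<Rightarrow> real vec pmf" where
  "qronos_first \<delta> X Xt w =
     bind_pmf
       (q_stoc \<delta> ((col Xt 0 \<bullet> (X *\<^sub>v w - cols_from Xt 1 *\<^sub>v vec_from w 1)) / (norm2 (col Xt 0))\<^sup>2))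
       (\<lambda>q1. return_pmf (vCons q1 (pinv (cols_from Xt 1) *\<^sub>v (X *\<^sub>v w - q1 \<cdot>\<^sub>v col Xt 0))))"

definition qronos_step :: "real \<Rightarrow> real mat \<Rightarrow> nat \<Rightarrow> real vec \<Rightarrow> real vec pmf" where
  "qronos_step \<delta> L t v =
     bind_pmf (q_stoc \<delta> (v $ t))
       (\<lambda>qt. return_pmf (vec (dim_vec v) (\<lambda>i.
          if i < t then v $ i
          else if i = t then qt
          else v $ i - L $$ (i, t) * (v $ t - qt) / L $$ (t, t))))"

text \<open>\<open>qronos_state \<delta> X Xt w k\<close> is the state after the steps for the columns \<open>0, \<dots>, k\<close>.\<close>

primrec qronos_state ::
  "real \<Rightarrow> real mat \<Rightarrow> real mat \<Rightarrow> real vec \<Rightarrow> nat \<Rightarrow> real vec pmf" where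
  "qronos_state \<delta> X Xt w 0 = qronos_first \<delta> X Xt w"
| "qronos_state \<delta> X Xt w (Suc k) =
     bind_pmf (qronos_state \<delta> X Xt w k)
       (qronos_step \<delta> (cholesky_factor (the (mat_inverse (transpose_mat Xt * Xt)))) (Suc k))"

definition qronos :: "real \<Rightarrow> real mat \<Rightarrow> real mat \<Rightarrow> real vec \<Rightarrow> real vec pmf" where
  "qronos \<delta> X Xt w = qronos_state \<delta> X Xt w (dim_col Xt - 1)"

end

theory Submission
  imports Defs
begin

text \<open>The error $Xw - \widetilde X v$ of the state $v$ changes in the step for column $t$ by
  $(z_t - q_t)\, d_t$, where $z_t$ is the input of the quantizer and
  $d_t = P_{\widetilde X_{\ge t+1}^{\perp}} \widetilde X_t$ (\<open>dir t\<close>). If $L$ is the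
  Cholesky factor of $(\widetilde X^\top \widetilde X)^{-1}$, then $U = \widetilde X L$ has
  orthonormal columns and $d_t = U_t / L_{tt}$, so by Bessel's inequality
  $\sum_t d_{t,i}^2 \le \max_t \|d_t\|^2$ for each coordinate $i$. The noise $z_t - q_t$ has
  conditional mean zero and lies in an interval of length $\delta$; Hoeffding's lemma and a union
  bound over the coordinates give the failure probability at most $2 m N^{-4 \pi p}$. If
  $N^p < \sqrt 2\, m$, the claimed lower bound is negative; otherwise $N^p \ge \sqrt 2$, which makes
  $2 N^{-4 \pi p} < \sqrt 2\, N^{-p}$.\<close>

section \<open>Pseudoinverses and Cholesky factors\<close>

text \<open>A nonzero kernel vector is a linear dependence among the columns. Since
  \<open>rank\<close> is read off from the set of columns, repeated columns are excluded first: they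
  would leave fewer than \<open>n\<close> candidates for an independent subset, against rank
  \<open>n\<close>.\<close>

lemma full_rank_imp_injective:
  fixes A :: "real mat"
  assumes A: "A \<in> carrier_mat m n" and rank: "vec_space.rank m A = n"
    and v: "v \<in> carrier_vec n" and Av: "A *\<^sub>v v = 0\<^sub>v m"
  shows "v = 0\<^sub>v n"
proof (rule ccontr)
  assume v0: "v \<noteq> 0\<^sub>v n"
  interpret vec_space "TYPE(real)" m .
  have dist: "distinct (cols A)"
  proof (rule ccontr)
    assume nd: "\<not> distinct (cols A)"
    obtain S where S: "maximal S (\<lambda>T. T \<subseteq> set (cols A) \<and> lin_indpt T)"
      using maximal_exists[of "(\<lambda>T. T \<subseteq> set (cols A) \<and> lin_indpt T)" "card (set (cols A))" "{}"]
      by (meson List.finite_set card_mono empty_iff empty_subsetI finite_lin_indpt2 rev_finite_subset)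
    then have "card S \<le> card (set (cols A))" by (simp add: card_mono maximal_def)
    also have "\<dots> < n"
      using nd card_length[of "cols A"] card_distinct[of "cols A"] A by (auto simp: le_less)
    finally show False using rank_card_indpt[OF A S] rank by simp
  qed
  show False
    using lin_depI[OF A v v0 Av dist] full_rank_lin_indpt[OF A rank dist] by blast
qed

lemma scalar_prod_self_eq_sum: "v \<bullet> v = (\<Sum>i<dim_vec v. (v $ i)\<^sup>2)" for v :: "real vec"
  by (simp add: scalar_prod_def power2_eq_square atLeast0LessThan)

lemma scalar_prod_self_eq_0:
  fixes v :: "real vec"
  assumes "v \<in> carrier_vec n" "v \<bullet> v = 0"
  shows "v = 0\<^sub>v n"
  using assms by (intro eq_vecI) (auto simp: scalar_prod_self_eq_sum sum_nonneg_eq_0_iff)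

text \<open>Both \<open>A * B\<close> and \<open>A * C\<close> are symmetric projections onto the
  column space of \<open>A\<close>, so they agree; likewise \<open>B * A\<close> and
  \<open>C * A\<close>. Transposing a product of two symmetric matrices swaps its factors, which
  turns absorption on one side into absorption on the other. Then \<open>B = B * A * B\<close> may
  be rewritten into \<open>C * A * C = C\<close>.\<close>

lemma is_pseudoinverse_unique:
  assumes "is_pseudoinverse A B" "is_pseudoinverse A C"
  shows "B = C"
proof -
  define m n where "m = dim_row A" and "n = dim_col A"
  have A: "A \<in> carrier_mat m n" by (auto simp: m_def n_def)
  have B: "B \<in> carrier_mat n m" and C: "C \<in> carrier_mat n m"
    using assms by (auto simp: is_pseudoinverse_def m_def n_def)
  have ABA: "A * B * A = A" and ACA: "A * C * A = A"
    and BAB: "B * A * B = B" and CAC: "C * A * C = C"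
    and sym: "transpose_mat (A * B) = A * B" "transpose_mat (A * C) = A * C"
      "transpose_mat (B * A) = B * A" "transpose_mat (C * A) = C * A"
    using assms by (auto simp only: is_pseudoinverse_def)
  have AB: "A * B \<in> carrier_mat m m" and AC: "A * C \<in> carrier_mat m m"
    and BA: "B * A \<in> carrier_mat n n" and CA: "C * A \<in> carrier_mat n n" using A B C by auto
  have "A * B = A * C * (A * B)"
    by (simp only: assoc_mult_mat[OF AC A B, symmetric] ACA)
  also have "\<dots> = transpose_mat (A * B * (A * C))"
    by (simp only: transpose_mult[OF AB AC] sym)
  also have "\<dots> = A * C"
    by (simp only: assoc_mult_mat[OF AB A C, symmetric] ABA sym)
  finally have 1: "A * B = A * C" .
  have "B * A = B * A * (C * A)"
    by (simp only: assoc_mult_mat[OF B A CA] assoc_mult_mat[OF A C A, symmetric] ACA)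
  also have "\<dots> = transpose_mat (C * A * (B * A))"
    by (simp only: transpose_mult[OF CA BA] sym)
  also have "\<dots> = C * A"
    by (simp only: assoc_mult_mat[OF C A BA] assoc_mult_mat[OF A B A, symmetric] ABA sym)
  finally have 2: "B * A = C * A" .
  have "B = B * (A * B)" by (simp only: assoc_mult_mat[OF B A B, symmetric] BAB)
  also have "\<dots> = C * A * C" by (simp only: 1 assoc_mult_mat[OF B A C, symmetric] 2)
  finally show ?thesis by (simp only: CAC)
qed

lemma pinv_eqI: "is_pseudoinverse A B \<Longrightarrow> pinv A = B"
  unfolding pinv_def by (blast intro: is_pseudoinverse_unique)

text \<open>From \<open>U = A * R\<close> and orthonormality, \<open>transpose_mat U * A\<close> is
  a left inverse of the square matrix \<open>R\<close>, hence also a right inverse, so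
  \<open>R * transpose_mat U\<close> is a left inverse of \<open>A\<close>. This gives explicit
  projections both for the trailing columns and for a single column.\<close>

lemma pinv_orthonormalization:
  assumes A: "A \<in> carrier_mat m n" and R: "R \<in> carrier_mat n n"
    and U: "U = A * R" and orth: "transpose_mat U * U = 1\<^sub>m n"
  shows "pinv A = R * transpose_mat U"
    and "A * pinv A = U * transpose_mat U"
    and "A * pinv A * A = A"
proof -
  have Uc: "U \<in> carrier_mat m n" using A R U by auto
  have Ut: "transpose_mat U \<in> carrier_mat n m" using Uc by auto
  define B where "B = R * transpose_mat U"
  have B: "B \<in> carrier_mat n m" using R Ut by (auto simp: B_def)
  have AB: "A * B = U * transpose_mat U"
    unfolding B_def U using assoc_mult_mat[OF A R Ut] U by simp
  have "transpose_mat U * A * R = 1\<^sub>m n"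
    using orth U assoc_mult_mat[OF Ut A R] by simp
  from mat_mult_left_right_inverse[OF _ R this]
  have BA: "B * A = 1\<^sub>m n" using A R Ut assoc_mult_mat[OF R Ut A] by (auto simp: B_def)
  have "is_pseudoinverse A B"
    unfolding is_pseudoinverse_def
  proof (intro conjI)
    show "A * B * A = A" using assoc_mult_mat[OF A B A] BA A by simp
    show "transpose_mat (A * B) = A * B"
      unfolding AB using transpose_mult[OF Uc Ut] by simp
  qed (use A B BA in auto)
  then show *: "pinv A = R * transpose_mat U" by (simp add: pinv_eqI B_def)
  show "A * pinv A = U * transpose_mat U" using AB * by (simp add: B_def)
  show "A * pinv A * A = A"
    using assoc_mult_mat[OF A B A] BA A * by (simp add: B_def)
qed

text \<open>The sum stops at \<open>j\<close> because row \<open>j\<close> of \<open>L\<close>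
  vanishes beyond the diagonal. This is the recursion that determines a Cholesky factor column by
  column.\<close>

lemma mult_lower_transpose_entry:
  fixes L :: "real mat"
  assumes L: "L \<in> carrier_mat n n" and low: "\<And>i j. i < n \<Longrightarrow> j < n \<Longrightarrow> i < j \<Longrightarrow> L $$ (i, j) = 0"
    and ij: "i < n" "j < n"
  shows "(L * transpose_mat L) $$ (i, j) = (\<Sum>k<j. L $$ (i, k) * L $$ (j, k)) + L $$ (i, j) * L $$ (j, j)"
proof -
  have "(L * transpose_mat L) $$ (i, j) = (\<Sum>k<n. L $$ (i, k) * L $$ (j, k))"
    using L ij by (simp add: scalar_prod_def atLeast0LessThan)
  also have "\<dots> = (\<Sum>k<Suc j. L $$ (i, k) * L $$ (j, k))"
    using ij low by (intro sum.mono_neutral_right) auto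
  finally show ?thesis by simp
qed

lemma is_cholesky_factorD:
  assumes "is_cholesky_factor M L" and n: "dim_row M = n"
  shows "L \<in> carrier_mat n n"
    and "\<And>i j. i < n \<Longrightarrow> j < n \<Longrightarrow> i < j \<Longrightarrow> L $$ (i, j) = 0"
    and "\<And>i. i < n \<Longrightarrow> 0 < L $$ (i, i)"
    and "L * transpose_mat L = M"
proof -
  note D = assms(1)[unfolded is_cholesky_factor_def n]
  note D' = D[THEN conjunct2] and D'' = D[THEN conjunct2, THEN conjunct2]
  show "L \<in> carrier_mat n n" by (rule D[THEN conjunct1])
  show "L $$ (i, j) = 0" if "i < n" "j < n" "i < j" for i j
    using D'[THEN conjunct1] that by simp
  show "0 < L $$ (i, i)" if "i < n" for i
    using D''[THEN conjunct1] that by simp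
  show "L * transpose_mat L = M"
    by (rule D''[THEN conjunct2, symmetric])
qed

text \<open>Induction over the columns: once the earlier columns agree, the recursion fixes the
  products \<open>L $$ (i, j) * L $$ (j, j)\<close>. The case \<open>i = j\<close> fixes the
  diagonal entry up to sign, positivity fixes the sign, and division gives the rest of the
  column.\<close>

lemma is_cholesky_factor_unique:
  assumes chol: "is_cholesky_factor M L" "is_cholesky_factor M K"
  shows "L = K"
proof -
  define n where "n = dim_row M"
  note L = is_cholesky_factorD(1)[OF chol(1) n_def[symmetric]]
    and K = is_cholesky_factorD(1)[OF chol(2) n_def[symmetric]]
    and lowL = is_cholesky_factorD(2)[OF chol(1) n_def[symmetric]]
    and lowK = is_cholesky_factorD(2)[OF chol(2) n_def[symmetric]]
    and posL = is_cholesky_factorD(3)[OF chol(1) n_def[symmetric]]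
    and posK = is_cholesky_factorD(3)[OF chol(2) n_def[symmetric]]
  have eq: "L * transpose_mat L = K * transpose_mat K"
    by (simp only: is_cholesky_factorD(4)[OF chol(1) refl] is_cholesky_factorD(4)[OF chol(2) refl])
  have "j < n \<longrightarrow> (\<forall>i<n. L $$ (i, j) = K $$ (i, j))" for j
  proof (induction j rule: less_induct)
    case (less j)
    show ?case
    proof (intro impI allI)
      fix i assume j: "j < n" and i: "i < n"
      have *: "L $$ (i, j) * L $$ (j, j) = K $$ (i, j) * K $$ (j, j)" if "i < n" for i
      proof -
        have "(\<Sum>k<j. L $$ (i, k) * L $$ (j, k)) = (\<Sum>k<j. K $$ (i, k) * K $$ (j, k))"
          using less j that by (intro sum.cong) auto
        then show ?thesis
          using mult_lower_transpose_entry[OF L lowL that j]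
            mult_lower_transpose_entry[OF K lowK that j] eq by simp
      qed
      have "(L $$ (j, j))\<^sup>2 = (K $$ (j, j))\<^sup>2" using *[OF j] by (simp add: power2_eq_square)
      then have "L $$ (j, j) = K $$ (j, j)"
        using posL[OF j] posK[OF j] by (simp add: power2_eq_iff_nonneg)
      then show "L $$ (i, j) = K $$ (i, j)" using *[OF i] posK[OF j] by simp
    qed
  qed
  then show ?thesis using L K by (intro eq_matI) auto
qed

lemma cholesky_factor_eqI: "is_cholesky_factor M L \<Longrightarrow> cholesky_factor M = L"
  unfolding cholesky_factor_def by (blast intro: is_cholesky_factor_unique)

section \<open>Linear systems behind the backward Gram-Schmidt process\<close>

lemma injective_imp_surjective_mat:
  fixes B :: "real mat"
  assumes B: "B \<in> carrier_mat n n"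
    and inj: "\<And>v. v \<in> carrier_vec n \<Longrightarrow> B *\<^sub>v v = 0\<^sub>v n \<Longrightarrow> v = 0\<^sub>v n"
    and b: "b \<in> carrier_vec n"
  obtains x where "x \<in> carrier_vec n" "B *\<^sub>v x = b"
proof -
  have "det B \<noteq> 0" using det_0_iff_vec_prod_zero[OF B] inj by auto
  from det_non_zero_imp_unit[OF B this, of "()"]
  obtain C where C: "C \<in> carrier_mat n n" "B * C = 1\<^sub>m n"
    by (auto simp: Units_def ring_mat_def)
  have "B *\<^sub>v (C *\<^sub>v b) = b" using assoc_mult_mat_vec[OF B C(1) b] C(2) b by simp
  then show ?thesis using that[of "C *\<^sub>v b"] C(1) b by auto
qed

text \<open>Up to scaling, \<open>l\<close> solves the linear system whose rows before \<open>t\<close> are those of the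
  identity and whose other rows are those of the Gram matrix of \<open>A\<close>.\<close>

lemma backward_gram_schmidt_column:
  fixes A :: "real mat"
  assumes A: "A \<in> carrier_mat m n"
    and inj: "\<And>v. v \<in> carrier_vec n \<Longrightarrow> A *\<^sub>v v = 0\<^sub>v m \<Longrightarrow> v = 0\<^sub>v n"
    and t: "t < n"
  obtains l where "l \<in> carrier_vec n" "\<And>i. i < t \<Longrightarrow> l $ i = 0" "0 < l $ t"
    "\<And>s. t < s \<Longrightarrow> s < n \<Longrightarrow> col A s \<bullet> (A *\<^sub>v l) = 0" "(A *\<^sub>v l) \<bullet> (A *\<^sub>v l) = 1"
proof -
  define B where "B = mat n n (\<lambda>(s, k). if s < t then (if s = k then 1 else 0) else col A s \<bullet> col A k)"
  have B: "B \<in> carrier_mat n n" by (simp add: B_def)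
  have B_low: "(B *\<^sub>v v) $ s = v $ s" if "v \<in> carrier_vec n" "s < t" for v s
  proof -
    have "(B *\<^sub>v v) $ s = (\<Sum>k<n. (if s = k then 1 else 0) * v $ k)"
      using that t by (auto simp: B_def scalar_prod_def atLeast0LessThan)
    also have "\<dots> = (\<Sum>k<n. if s = k then v $ k else 0)" by (intro sum.cong) auto
    also have "\<dots> = v $ s" using that t by simp
    finally show ?thesis .
  qed
  have At: "transpose_mat A \<in> carrier_mat n m" using A by simp
  have B_high: "(B *\<^sub>v v) $ s = col A s \<bullet> (A *\<^sub>v v)" if "v \<in> carrier_vec n" "t \<le> s" "s < n" for v s
  proof -
    have "(B *\<^sub>v v) $ s = row (transpose_mat A * A) s \<bullet> v"
      using that A by (auto simp: B_def scalar_prod_def[of _ v] intro!: sum.cong)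
    also have "\<dots> = (transpose_mat A * A *\<^sub>v v) $ s"
      using that A by (intro index_mult_mat_vec[symmetric]) simp
    also have "\<dots> = (transpose_mat A *\<^sub>v (A *\<^sub>v v)) $ s"
      by (simp only: assoc_mult_mat_vec[OF At A that(1)])
    also have "\<dots> = col A s \<bullet> (A *\<^sub>v v)" using that A by simp
    finally show ?thesis .
  qed
  \<comment> \<open>Expanding one factor into columns of \<open>A\<close> leaves only column
    \<open>t\<close>: earlier coefficients vanish, and later columns are orthogonal to the
    vector.\<close>
  have energy: "(A *\<^sub>v v) \<bullet> (A *\<^sub>v v) = v $ t * (col A t \<bullet> (A *\<^sub>v v))"
    if v: "v \<in> carrier_vec n" and "\<And>s. s < t \<Longrightarrow> v $ s = 0"
      and "\<And>s. t < s \<Longrightarrow> s < n \<Longrightarrow> col A s \<bullet> (A *\<^sub>v v) = 0" for v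
  proof -
    have "(A *\<^sub>v v) \<bullet> (A *\<^sub>v v) = v \<bullet> (transpose_mat A *\<^sub>v (A *\<^sub>v v))"
      by (simp only: transpose_vec_mult_scalar[OF A v mult_mat_vec_carrier[OF A v], symmetric]
          comm_scalar_prod[OF v mult_mat_vec_carrier[OF At mult_mat_vec_carrier[OF A v]]])
    also have "\<dots> = (\<Sum>s<n. v $ s * (col A s \<bullet> (A *\<^sub>v v)))"
      using A v by (auto simp: scalar_prod_def[of v] atLeast0LessThan intro!: sum.cong)
    also have "\<dots> = (\<Sum>s\<in>{t}. v $ s * (col A s \<bullet> (A *\<^sub>v v)))"
      using that t by (intro sum.mono_neutral_right) (auto simp: linorder_neq_iff)
    finally show ?thesis by simp
  qed
  \<comment> \<open>For a kernel vector of \<open>B\<close> the energy identity gives zero norm of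
    \<open>A *\<^sub>v v\<close>, so injectivity of \<open>A\<close> passes to \<open>B\<close> and
    the system is solvable.\<close>
  have "v = 0\<^sub>v n" if v: "v \<in> carrier_vec n" and Bv: "B *\<^sub>v v = 0\<^sub>v n" for v
  proof -
    have low: "v $ s = 0" if "s < t" for s using B_low[OF v that] Bv that t by simp
    have high: "col A s \<bullet> (A *\<^sub>v v) = 0" if "t \<le> s" "s < n" for s
      using B_high[OF v that] Bv that by simp
    have "(A *\<^sub>v v) \<bullet> (A *\<^sub>v v) = 0" using energy[OF v low high] high[of t] t by simp
    then show ?thesis
      by (intro inj[OF v] scalar_prod_self_eq_0 mult_mat_vec_carrier[OF A v])
  qed
  then obtain x where x: "x \<in> carrier_vec n" "B *\<^sub>v x = unit_vec n t"
    using injective_imp_surjective_mat[OF B _ unit_vec_carrier] by blast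
  have low: "x $ s = 0" if "s < t" for s using B_low[OF x(1) that] x(2) that t by simp
  have high: "col A s \<bullet> (A *\<^sub>v x) = (if s = t then 1 else 0)" if "t \<le> s" "s < n" for s
    using B_high[OF x(1) that] x(2) that t by simp
  have en: "(A *\<^sub>v x) \<bullet> (A *\<^sub>v x) = x $ t"
    using energy[OF x(1) low] high t by simp
  have "x $ t \<noteq> 0"
  proof
    assume "x $ t = 0"
    then have "A *\<^sub>v x = 0\<^sub>v m"
      using en by (intro scalar_prod_self_eq_0 mult_mat_vec_carrier[OF A x(1)]) simp
    then show False using high[of t] t A by simp
  qed
  moreover have "0 \<le> x $ t" using en by (metis scalar_prod_self_eq_sum sum_nonneg zero_le_power2)
  ultimately have pos: "0 < x $ t" by simp
  \<comment> \<open>The squared norm of \<open>A *\<^sub>v x\<close> is \<open>x $ t\<close>, so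
    this factor normalizes it and keeps the entry at \<open>t\<close> positive.\<close>
  define l where "l = (1 / sqrt (x $ t)) \<cdot>\<^sub>v x"
  have Al: "A *\<^sub>v l = (1 / sqrt (x $ t)) \<cdot>\<^sub>v (A *\<^sub>v x)"
    unfolding l_def using mult_mat_vec[OF A x(1)] .
  show ?thesis
  proof
    show "l \<in> carrier_vec n" using x by (simp add: l_def)
    show "l $ i = 0" if "i < t" for i using low[OF that] that t x by (simp add: l_def)
    show "0 < l $ t" using pos t x by (simp add: l_def)
    show "col A s \<bullet> (A *\<^sub>v l) = 0" if "t < s" "s < n" for s
      unfolding Al using high[of s] that A by simp
    show "(A *\<^sub>v l) \<bullet> (A *\<^sub>v l) = 1"
      unfolding Al using en pos A by (simp add: field_simps)
  qed
qed

lemma mult_mat_vec_split: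
  fixes A :: "real mat"
  assumes A: "A \<in> carrier_mat m n" and v: "v \<in> carrier_vec n" and t: "t \<le> n" and r: "r < m"
  shows "(A *\<^sub>v v) $ r = (\<Sum>i<t. A $$ (r, i) * v $ i) + (cols_from A t *\<^sub>v vec_from v t) $ r"
proof -
  have "(A *\<^sub>v v) $ r = (\<Sum>i<n. A $$ (r, i) * v $ i)"
    using A v r by (simp add: scalar_prod_def atLeast0LessThan)
  also have "\<dots> = (\<Sum>i<t. A $$ (r, i) * v $ i) + (\<Sum>i\<in>{t..<n}. A $$ (r, i) * v $ i)"
    using t by (subst sum.union_disjoint[symmetric]) (auto intro!: sum.cong)
  also have "(\<Sum>i\<in>{t..<n}. A $$ (r, i) * v $ i) = (\<Sum>k<n-t. A $$ (r, t + k) * v $ (t + k))"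
    by (rule sum.reindex_bij_witness[of _ "\<lambda>k. t + k" "\<lambda>i. i - t"]) auto
  also have "\<dots> = (cols_from A t *\<^sub>v vec_from v t) $ r"
    using A v r by (simp add: cols_from_def vec_from_def scalar_prod_def atLeast0LessThan)
  finally show ?thesis .
qed

section \<open>Matrices of full column rank\<close>

text \<open>The columns supplied by \<open>backward_gram_schmidt_column\<close> form a lower
  triangular \<open>K\<close> with positive diagonal such that \<open>A * K\<close> has orthonormal
  columns. For the Gram matrix \<open>G\<close> this means that \<open>K * transpose_mat K\<close>
  inverts \<open>G\<close>, and uniqueness of the Cholesky factor identifies \<open>K\<close> with
  \<open>L\<close>.\<close>

lemma full_rank_cholesky:
  fixes A :: "real mat"
  assumes A: "A \<in> carrier_mat m n"
    and inj: "\<And>v. v \<in> carrier_vec n \<Longrightarrow> A *\<^sub>v v = 0\<^sub>v m \<Longrightarrow> v = 0\<^sub>v n"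
  defines "L \<equiv> cholesky_factor (the (mat_inverse (transpose_mat A * A)))"
  shows "L \<in> carrier_mat n n"
    and "\<And>i j. i < j \<Longrightarrow> j < n \<Longrightarrow> L $$ (i, j) = 0"
    and "\<And>i. i < n \<Longrightarrow> 0 < L $$ (i, i)"
    and "transpose_mat (A * L) * (A * L) = 1\<^sub>m n"
proof -
  have "\<exists>l. l \<in> carrier_vec n \<and> (\<forall>i<t. l $ i = 0) \<and> 0 < l $ t \<and>
    (\<forall>s. t < s \<longrightarrow> s < n \<longrightarrow> col A s \<bullet> (A *\<^sub>v l) = 0) \<and> (A *\<^sub>v l) \<bullet> (A *\<^sub>v l) = 1"
    if "t < n" for t
    by (rule backward_gram_schmidt_column[OF A inj that]) blast+
  then obtain l where *: "\<And>t. t < n \<Longrightarrow> l t \<in> carrier_vec n \<and> (\<forall>i<t. l t $ i = 0) \<and> 0 < l t $ t \<and>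
    (\<forall>s. t < s \<longrightarrow> s < n \<longrightarrow> col A s \<bullet> (A *\<^sub>v l t) = 0) \<and> (A *\<^sub>v l t) \<bullet> (A *\<^sub>v l t) = 1"
    by metis
  have l: "l t \<in> carrier_vec n" and low: "\<And>i. i < t \<Longrightarrow> l t $ i = 0" and pos: "0 < l t $ t"
    and perp: "\<And>s. t < s \<Longrightarrow> s < n \<Longrightarrow> col A s \<bullet> (A *\<^sub>v l t) = 0"
    and unit: "(A *\<^sub>v l t) \<bullet> (A *\<^sub>v l t) = 1"
    if "t < n" for t
    using *[OF that] by simp_all
  define K where "K = mat n n (\<lambda>(i, t). l t $ i)"
  have K: "K \<in> carrier_mat n n" by (simp add: K_def)
  have col_K: "col K t = l t" if "t < n" for t
    using l[OF that] that by (auto simp: K_def)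
  have At: "transpose_mat A \<in> carrier_mat n m" and Kt: "transpose_mat K \<in> carrier_mat n n"
    using A K by auto
  \<comment> \<open>The first vector combines only columns \<open>k\<close> with
    \<open>s \<le> k\<close>; these come after \<open>t\<close> and are orthogonal to
    \<open>A *\<^sub>v l t\<close>.\<close>
  have orth_lt: "(A *\<^sub>v l s) \<bullet> (A *\<^sub>v l t) = 0" if "t < s" "s < n" for s t
  proof -
    have t: "t < n" using that by simp
    note lsc = l[OF that(2)] and ltc = l[OF t]
    have "(A *\<^sub>v l s) \<bullet> (A *\<^sub>v l t) = l s \<bullet> (transpose_mat A *\<^sub>v (A *\<^sub>v l t))"
      by (simp only: comm_scalar_prod[OF mult_mat_vec_carrier[OF A lsc] mult_mat_vec_carrier[OF A ltc]]
          transpose_vec_mult_scalar[OF A lsc mult_mat_vec_carrier[OF A ltc], symmetric]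
          comm_scalar_prod[OF lsc mult_mat_vec_carrier[OF At mult_mat_vec_carrier[OF A ltc]]])
    also have "\<dots> = (\<Sum>k<n. l s $ k * (col A k \<bullet> (A *\<^sub>v l t)))"
      using A lsc by (auto simp: scalar_prod_def[of "l s"] atLeast0LessThan intro!: sum.cong)
    also have "\<dots> = 0"
    proof (intro sum.neutral ballI)
      fix k assume "k \<in> {..<n}"
      then show "l s $ k * (col A k \<bullet> (A *\<^sub>v l t)) = 0"
        using low[OF that(2), of k] perp[OF t, of k] that by (cases "k < s") auto
    qed
    finally show ?thesis .
  qed
  have orth: "transpose_mat (A * K) * (A * K) = 1\<^sub>m n"
  proof (rule eq_matI)
    fix s t assume "s < dim_row (1\<^sub>m n :: real mat)" "t < dim_col (1\<^sub>m n :: real mat)"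
    then have st: "s < n" "t < n" by auto
    have "(transpose_mat (A * K) * (A * K)) $$ (s, t) = (A *\<^sub>v l s) \<bullet> (A *\<^sub>v l t)"
      using st A K col_K by (simp add: mult_mat_vec_def)
    also have "\<dots> = (if s = t then 1 else 0)"
    proof (cases s t rule: linorder_cases)
      case less
      then show ?thesis
        using orth_lt[OF less st(2)] comm_scalar_prod[OF mult_mat_vec_carrier[OF A l[OF st(1)]]
            mult_mat_vec_carrier[OF A l[OF st(2)]]] by simp
    qed (use orth_lt unit st in auto)
    finally show "(transpose_mat (A * K) * (A * K)) $$ (s, t) = 1\<^sub>m n $$ (s, t)" using st by simp
  qed (use A K in auto)
  define G where "G = transpose_mat A * A"
  have G: "G \<in> carrier_mat n n" using A At by (auto simp: G_def)
  have KKt: "K * transpose_mat K \<in> carrier_mat n n" using K Kt by auto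
  \<comment> \<open>One-sided inverses of square matrices are two-sided. Using this twice, the
    factors are rotated until \<open>K * transpose_mat K\<close> inverts \<open>G\<close> on both
    sides.\<close>
  have "transpose_mat K * (G * K) = 1\<^sub>m n"
    using orth
    by (simp only: transpose_mult[OF A K] assoc_mult_mat[OF Kt At mult_carrier_mat[OF A K]] G_def
        assoc_mult_mat[OF At A K])
  from mat_mult_left_right_inverse[OF Kt mult_carrier_mat[OF G K] this]
  have GK: "G * (K * transpose_mat K) = 1\<^sub>m n"
    by (simp only: assoc_mult_mat[OF G K Kt])
  from mat_mult_left_right_inverse[OF G KKt this]
  have KG: "K * transpose_mat K * G = 1\<^sub>m n" .
  \<comment> \<open>Invertibility rules out the value \<open>None\<close> of
    \<open>mat_inverse G\<close>.\<close>
  have "G \<in> Units (ring_mat TYPE(real) n ())"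
    using G KKt GK KG by (auto simp: Units_def ring_mat_def)
  then obtain B where B: "mat_inverse G = Some B"
    using mat_inverse(1)[OF G, of "()"] by (cases "mat_inverse G") auto
  note BG = mat_inverse(2)[OF G B]
  then have Bc: "B \<in> carrier_mat n n" by simp
  have "B = B * (G * (K * transpose_mat K))" using Bc by (simp only: GK) simp
  also have "\<dots> = B * G * (K * transpose_mat K)" by (rule assoc_mult_mat[OF Bc G KKt, symmetric])
  also have "\<dots> = K * transpose_mat K" using BG left_mult_one_mat[OF KKt] by simp
  finally have inv: "the (mat_inverse G) = K * transpose_mat K" using B by simp
  have "is_cholesky_factor (K * transpose_mat K) K"
    unfolding is_cholesky_factor_def using K low pos by (simp add: K_def)
  then have LK: "L = K" unfolding L_def G_def[symmetric] inv by (rule cholesky_factor_eqI)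
  show "L \<in> carrier_mat n n" "transpose_mat (A * L) * (A * L) = 1\<^sub>m n"
    unfolding LK by (fact K, fact orth)
  show "L $$ (i, j) = 0" if "i < j" "j < n" for i j using low that by (simp add: LK K_def)
  show "0 < L $$ (i, i)" if "i < n" for i using pos that by (simp add: LK K_def)
qed

section \<open>Bessel's inequality and projections off the trailing columns\<close>

text \<open>Bessel's inequality for a standard basis vector. If \<open>a\<close> is row
  \<open>i\<close> of \<open>U\<close> with squared norm \<open>S\<close>, then
  \<open>U *\<^sub>v a\<close> has squared norm \<open>S\<close> as well, while its entry
  \<open>i\<close> equals \<open>S\<close>; hence \<open>S * S\<close> is at most
  \<open>S\<close>.\<close>

lemma orthonormal_cols_row_sum_le_1:
  fixes U :: "real mat"
  assumes U: "U \<in> carrier_mat m n" and orth: "transpose_mat U * U = 1\<^sub>m n" and i: "i < m"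
  shows "(\<Sum>t<n. (U $$ (i, t))\<^sup>2) \<le> 1"
proof -
  have Ut: "transpose_mat U \<in> carrier_mat n m" using U by simp
  define a where "a = row U i"
  have a: "a \<in> carrier_vec n" using U i by (auto simp: a_def)
  define S where "S = (\<Sum>t<n. (U $$ (i, t))\<^sup>2)"
  have aa: "a \<bullet> a = S" using U i by (simp add: scalar_prod_self_eq_sum a_def S_def)
  have "(U *\<^sub>v a) \<bullet> (U *\<^sub>v a) = (transpose_mat U *\<^sub>v (U *\<^sub>v a)) \<bullet> a"
    by (rule transpose_vec_mult_scalar[OF U a mult_mat_vec_carrier[OF U a], symmetric])
  also have "\<dots> = S"
    by (simp only: assoc_mult_mat_vec[OF Ut U a, symmetric] orth one_mult_mat_vec[OF a] aa)
  finally have "(\<Sum>k<m. ((U *\<^sub>v a) $ k)\<^sup>2) = S" using U by (simp add: scalar_prod_self_eq_sum)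
  moreover have "((U *\<^sub>v a) $ i)\<^sup>2 \<le> (\<Sum>k<m. ((U *\<^sub>v a) $ k)\<^sup>2)"
    using i by (intro member_le_sum) auto
  moreover have "(U *\<^sub>v a) $ i = S" using U i aa by (simp add: a_def)
  ultimately have "S * S \<le> S * 1" by (simp add: power2_eq_square)
  moreover have "0 \<le> S" by (simp add: S_def sum_nonneg)
  ultimately have "S \<le> 1" by (cases "S = 0") (auto simp: mult_le_cancel_left)
  then show ?thesis by (simp add: S_def)
qed

text \<open>Full rank enters as a trivial kernel, the form in which the Gram-Schmidt construction
  uses it. The updates of the algorithm are expressed through \<open>L\<close>, the error through
  the orthonormal columns of \<open>U\<close>.\<close>

locale full_column_rank =
  fixes A :: "real mat" and m n :: nat and L U :: "real mat"
  assumes A: "A \<in> carrier_mat m n"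
    and inj: "\<And>v. v \<in> carrier_vec n \<Longrightarrow> A *\<^sub>v v = 0\<^sub>v m \<Longrightarrow> v = 0\<^sub>v n"
  defines "L \<equiv> cholesky_factor (the (mat_inverse (transpose_mat A * A)))"
    and "U \<equiv> A * L"
begin

lemma L: "L \<in> carrier_mat n n"
  and L_low: "\<And>i j. i < j \<Longrightarrow> j < n \<Longrightarrow> L $$ (i, j) = 0"
  and L_pos: "\<And>i. i < n \<Longrightarrow> 0 < L $$ (i, i)"
  and U_orth: "transpose_mat U * U = 1\<^sub>m n"
  unfolding U_def L_def using full_rank_cholesky[OF A inj] by blast+

lemma U: "U \<in> carrier_mat m n"
  using A L by (auto simp: U_def)

lemma col_U: "t < n \<Longrightarrow> col U t = A *\<^sub>v col L t"
  unfolding U_def using col_mult2[OF A L] .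

lemma cols_from_carrier: "cols_from A t \<in> carrier_mat m (n - t)"
  using A by (simp add: cols_from_def)

text \<open>The first \<open>t\<close> entries of every column of \<open>L\<close> from
  \<open>t\<close> on are zero, so the trailing columns of \<open>U\<close> involve trailing columns
  of \<open>A\<close> only. This is the factorization that \<open>pinv_orthonormalization\<close>
  requires.\<close>

lemma cols_from_U:
  assumes t: "t \<le> n"
  shows "cols_from U t = cols_from A t * mat (n - t) (n - t) (\<lambda>(i, j). L $$ (t + i, t + j))"
    (is "_ = _ * ?R")
proof (rule eq_matI)
  fix r j assume "r < dim_row (cols_from A t * ?R)" "j < dim_col (cols_from A t * ?R)"
  then have r: "r < m" and j: "j < n - t" using A by (auto simp: cols_from_def)
  have j': "t + j < n" using j by simp
  have colL: "col L (t + j) \<in> carrier_vec n" using L by auto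
  have "col ?R j = vec_from (col L (t + j)) t"
    using j L by (intro eq_vecI) (auto simp: vec_from_def)
  then have "(cols_from A t * ?R) $$ (r, j) = (cols_from A t *\<^sub>v vec_from (col L (t + j)) t) $ r"
    using r j A by (simp add: cols_from_def)
  also have "\<dots> = (A *\<^sub>v col L (t + j)) $ r"
    using mult_mat_vec_split[OF A colL t r] L L_low[of _ "t + j"] j' by simp
  also have "\<dots> = cols_from U t $$ (r, j)"
    using col_U[OF j'] r j U by (metis (no_types, lifting) carrier_matD cols_from_def index_col
        index_mat(1) case_prod_conv j')
  finally show "cols_from U t $$ (r, j) = (cols_from A t * ?R) $$ (r, j)" by simp
qed (use A U in \<open>auto simp: cols_from_def\<close>)

lemma cols_from_U_orth:
  assumes t: "t \<le> n"
  shows "transpose_mat (cols_from U t) * cols_from U t = 1\<^sub>m (n - t)"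
proof (rule eq_matI)
  fix i j assume "i < dim_row (1\<^sub>m (n - t) :: real mat)" "j < dim_col (1\<^sub>m (n - t) :: real mat)"
  then have ij: "i < n - t" "j < n - t" by auto
  have "(transpose_mat (cols_from U t) * cols_from U t) $$ (i, j) = (transpose_mat U * U) $$ (t + i, t + j)"
    using ij U by (simp add: cols_from_def scalar_prod_def)
  then show "(transpose_mat (cols_from U t) * cols_from U t) $$ (i, j) = 1\<^sub>m (n - t) $$ (i, j)"
    using ij by (simp add: U_orth)
qed (use U in \<open>auto simp: cols_from_def\<close>)

text \<open>The case \<open>t = n\<close> is included: there are no columns left, and the projection
  is the identity.\<close>

lemma
  assumes t: "t \<le> n"
  shows proj_carrier: "proj_perp (cols_from A t) \<in> carrier_mat m m"
  and proj_eq: "proj_perp (cols_from A t) =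
    1\<^sub>m m - cols_from U t * transpose_mat (cols_from U t)"
  and pinv_carrier: "pinv (cols_from A t) \<in> carrier_mat (n - t) m"
  and cols_from_pinv: "cols_from A t * pinv (cols_from A t) * cols_from A t = cols_from A t"
proof -
  let ?R = "mat (n - t) (n - t) (\<lambda>(i, j). L $$ (t + i, t + j))"
  note P = pinv_orthonormalization[OF cols_from_carrier _ cols_from_U[OF t] cols_from_U_orth[OF t]]
  have U': "cols_from U t \<in> carrier_mat m (n - t)" using U by (simp add: cols_from_def)
  show "pinv (cols_from A t) \<in> carrier_mat (n - t) m"
    using P(1) U' by (auto intro!: mult_carrier_mat)
  show "cols_from A t * pinv (cols_from A t) * cols_from A t = cols_from A t"
    by (rule P(3)) simp
  show eq: "proj_perp (cols_from A t) = 1\<^sub>m m - cols_from U t * transpose_mat (cols_from U t)"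
    unfolding proj_perp_def using P(2) cols_from_carrier[of t] by simp
  show "proj_perp (cols_from A t) \<in> carrier_mat m m" unfolding eq using U' by auto
qed

lemma proj_perp_apply:
  assumes t: "t \<le> n" and y: "y \<in> carrier_vec m"
  shows "proj_perp (cols_from A t) *\<^sub>v y = y - cols_from A t *\<^sub>v (pinv (cols_from A t) *\<^sub>v y)"
proof -
  note C = cols_from_carrier[of t] and P = pinv_carrier[OF t]
  have "dim_row (cols_from A t) = m" using C by simp
  then show ?thesis
    unfolding proj_perp_def
    using minus_mult_distrib_mat_vec[OF one_carrier_mat mult_carrier_mat[OF C P] y]
      assoc_mult_mat_vec[OF C P y] y by simp
qed

lemma proj_perp_range:
  assumes t: "t \<le> n" and x: "x \<in> carrier_vec (n - t)"
  shows "proj_perp (cols_from A t) *\<^sub>v (cols_from A t *\<^sub>v x) = 0\<^sub>v m"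
proof -
  note C = cols_from_carrier[of t] and P = pinv_carrier[OF t]
  note y = mult_mat_vec_carrier[OF C x]
  have "cols_from A t *\<^sub>v (pinv (cols_from A t) *\<^sub>v (cols_from A t *\<^sub>v x)) = cols_from A t *\<^sub>v x"
    by (simp only: assoc_mult_mat_vec[OF C P y, symmetric] cols_from_pinv[OF t]
        assoc_mult_mat_vec[OF mult_carrier_mat[OF C P] C x, symmetric])
  then show ?thesis by (simp only: proj_perp_apply[OF t y] minus_cancel_vec[OF y])
qed

text \<open>The subtracted part is a combination of the later columns of \<open>U\<close>, with
  coefficients that vanish by orthonormality.\<close>

lemma proj_perp_col_U:
  assumes t: "t < n"
  shows "proj_perp (cols_from A (Suc t)) *\<^sub>v col U t = col U t"
proof -
  have St: "Suc t \<le> n" using t by simp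
  let ?U = "cols_from U (Suc t)"
  have U': "?U \<in> carrier_mat m (n - Suc t)" using U by (simp add: cols_from_def)
  have Ut: "transpose_mat ?U \<in> carrier_mat (n - Suc t) m" using U' by simp
  have u: "col U t \<in> carrier_vec m" using U by auto
  have 0: "transpose_mat ?U *\<^sub>v col U t = 0\<^sub>v (n - Suc t)"
  proof (rule eq_vecI)
    fix j assume "j < dim_vec (0\<^sub>v (n - Suc t) :: real vec)"
    then have j: "j < n - Suc t" by simp
    have "(transpose_mat ?U *\<^sub>v col U t) $ j = (transpose_mat U * U) $$ (Suc t + j, t)"
      using j t U by (simp add: cols_from_def scalar_prod_def)
    then show "(transpose_mat ?U *\<^sub>v col U t) $ j = 0\<^sub>v (n - Suc t) $ j"
      using j t by (simp add: U_orth)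
  qed (use U' in simp)
  have "?U * transpose_mat ?U *\<^sub>v col U t = 0\<^sub>v m"
    unfolding assoc_mult_mat_vec[OF U' Ut u] 0 using U' by (intro eq_vecI) auto
  then show ?thesis
    unfolding proj_eq[OF St]
    using minus_mult_distrib_mat_vec[OF one_carrier_mat mult_carrier_mat[OF U' Ut] u] u by simp
qed

definition dir :: "nat \<Rightarrow> real vec" where
  "dir t = proj_perp (cols_from A (Suc t)) *\<^sub>v col A t"

text \<open>Column \<open>t\<close> of \<open>U\<close> is \<open>L $$ (t, t)\<close> times column
  \<open>t\<close> of \<open>A\<close> plus a combination of later columns of \<open>A\<close>. The
  projection removes that combination and fixes \<open>col U t\<close>.\<close>

lemma dir_eq:
  assumes t: "t < n"
  shows "dir t = (1 / L $$ (t, t)) \<cdot>\<^sub>v col U t"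
proof -
  have St: "Suc t \<le> n" using t by simp
  note C = cols_from_carrier[of "Suc t"] and P = proj_carrier[OF St]
  have a: "col A t \<in> carrier_vec m" and l: "col L t \<in> carrier_vec n" using A L by auto
  have c: "vec_from (col L t) (Suc t) \<in> carrier_vec (n - Suc t)" using l L by (simp add: vec_from_def)
  have "col U t = L $$ (t, t) \<cdot>\<^sub>v col A t + cols_from A (Suc t) *\<^sub>v vec_from (col L t) (Suc t)"
    unfolding col_U[OF t]
  proof (rule eq_vecI)
    fix r assume "r < dim_vec (L $$ (t, t) \<cdot>\<^sub>v col A t + cols_from A (Suc t) *\<^sub>v vec_from (col L t) (Suc t))"
    then have r: "r < m" using C by simp
    have "(\<Sum>i<t. A $$ (r, i) * col L t $ i) = 0"
      using L_low[of _ t] t L by (intro sum.neutral) auto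
    then show "(A *\<^sub>v col L t) $ r
        = (L $$ (t, t) \<cdot>\<^sub>v col A t + cols_from A (Suc t) *\<^sub>v vec_from (col L t) (Suc t)) $ r"
      using mult_mat_vec_split[OF A l St r] A L C r t by simp
  qed (use A C in auto)
  then have "col U t = proj_perp (cols_from A (Suc t)) *\<^sub>v
      (L $$ (t, t) \<cdot>\<^sub>v col A t + cols_from A (Suc t) *\<^sub>v vec_from (col L t) (Suc t))"
    using proj_perp_col_U[OF t] by simp
  also have "\<dots> = L $$ (t, t) \<cdot>\<^sub>v dir t + 0\<^sub>v m"
    by (simp only: mult_add_distrib_mat_vec[OF P smult_carrier_vec[THEN iffD2, OF a] mult_mat_vec_carrier[OF C c]]
        mult_mat_vec[OF P a] proj_perp_range[OF St c] dir_def)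
  finally have *: "col U t = L $$ (t, t) \<cdot>\<^sub>v dir t + 0\<^sub>v m" .
  have d: "dir t \<in> carrier_vec m" using P a by (simp add: dir_def)
  show ?thesis unfolding * using d L_pos[OF t] by (intro eq_vecI) auto
qed

lemma norm2_dir: "t < n \<Longrightarrow> norm2 (dir t) = 1 / L $$ (t, t)"
proof -
  assume t: "t < n"
  have "col U t \<bullet> col U t = (transpose_mat U * U) $$ (t, t)" using t U by simp
  then have "col U t \<bullet> col U t = 1" using t by (simp add: U_orth)
  then show ?thesis
    using L_pos[OF t] by (simp add: norm2_def dir_eq[OF t] real_sqrt_divide real_sqrt_mult)
qed

lemma norm2_dir_pos: "t < n \<Longrightarrow> 0 < norm2 (dir t)"
  using norm2_dir L_pos by simp

text \<open>Each \<open>dir t\<close> is \<open>norm2 (dir t)\<close> times a column of an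
  orthonormal system, so Bessel's inequality bounds the sum over all steps by a single
  \<open>G\<^sup>2\<close>. Bounding the terms one by one would cost a factor
  \<open>n\<close>.\<close>

lemma sum_dir_sq_le:
  assumes i: "i < m" and G: "\<And>t. t < n \<Longrightarrow> norm2 (dir t) \<le> G"
  shows "(\<Sum>t<n. (dir t $ i)\<^sup>2) \<le> G\<^sup>2"
proof -
  have "(\<Sum>t<n. (dir t $ i)\<^sup>2) = (\<Sum>t<n. (norm2 (dir t))\<^sup>2 * (U $$ (i, t))\<^sup>2)"
  proof (intro sum.cong refl)
    fix t assume "t \<in> {..<n}"
    then have t: "t < n" by simp
    have "dir t $ i = U $$ (i, t) / L $$ (t, t)" using dir_eq[OF t] i U t by simp
    then show "(dir t $ i)\<^sup>2 = (norm2 (dir t))\<^sup>2 * (U $$ (i, t))\<^sup>2"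
      by (simp add: norm2_dir[OF t] power_divide)
  qed
  also have "\<dots> \<le> (\<Sum>t<n. G\<^sup>2 * (U $$ (i, t))\<^sup>2)"
    using G norm2_dir_pos by (intro sum_mono mult_right_mono power_mono) (auto simp: less_imp_le)
  also have "\<dots> = G\<^sup>2 * (\<Sum>t<n. (U $$ (i, t))\<^sup>2)" by (simp add: sum_distrib_left)
  also have "\<dots> \<le> G\<^sup>2 * 1"
    using orthonormal_cols_row_sum_le_1[OF U U_orth i] by (intro mult_left_mono) auto
  finally show ?thesis by simp
qed

end

section \<open>Change of the error in a rounding step\<close>

text \<open>For one column the orthonormalizing factor is the 1 by 1 matrix with entry
  \<open>1 / norm2 (col A j)\<close>, and the projection removes the component along the normalized
  column.\<close>

lemma proj_perp_col_mat:
  fixes A :: "real mat"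
  assumes A: "A \<in> carrier_mat m n" and pos: "0 < norm2 (col A j)" and y: "y \<in> carrier_vec m"
  shows "proj_perp (col_mat A j) *\<^sub>v y
    = y - ((col A j \<bullet> y) / (norm2 (col A j))\<^sup>2) \<cdot>\<^sub>v col A j"
proof -
  define a where "a = col A j"
  define c where "c = norm2 a"
  have a: "a \<in> carrier_vec m" using A by (auto simp: a_def)
  have c: "0 < c" and cc: "c * c = (\<Sum>r<m. a $ r * a $ r)"
    using pos a scalar_prod_self_eq_sum[of a]
    by (auto simp: c_def a_def[symmetric] norm2_def power2_eq_square sum_nonneg)
  have C: "col_mat A j \<in> carrier_mat m 1" using A by (intro carrier_matI) (auto simp: col_mat_def)
  define R :: "real mat" where "R = mat 1 1 (\<lambda>_. 1 / c)"
  define V where "V = col_mat A j * R"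
  have R: "R \<in> carrier_mat 1 1" by (simp add: R_def)
  have V: "V \<in> carrier_mat m 1" using C R by (simp add: V_def)
  have Vt: "transpose_mat V \<in> carrier_mat 1 m" using V by simp
  have V_entry: "V $$ (r, 0) = a $ r / c" if "r < m" for r
    using that A by (simp add: V_def R_def col_mat_def mat_of_cols_def scalar_prod_def a_def)
  have orth: "transpose_mat V * V = 1\<^sub>m 1"
  proof (rule eq_matI)
    fix s t assume "s < dim_row (1\<^sub>m 1 :: real mat)" "t < dim_col (1\<^sub>m 1 :: real mat)"
    then have st: "s = 0" "t = 0" by auto
    have "(transpose_mat V * V) $$ (0, 0) = (\<Sum>r<m. (a $ r / c) * (a $ r / c))"
      using V V_entry by (simp add: scalar_prod_def atLeast0LessThan)
    also have "\<dots> = (\<Sum>r<m. a $ r * a $ r) / (c * c)" by (simp add: sum_divide_distrib)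
    also have "\<dots> = 1" using c by (simp add: cc[symmetric])
    finally show "(transpose_mat V * V) $$ (s, t) = 1\<^sub>m 1 $$ (s, t)" by (simp add: st)
  qed (use V in auto)
  have P: "proj_perp (col_mat A j) = 1\<^sub>m m - V * transpose_mat V"
    unfolding proj_perp_def pinv_orthonormalization(2)[OF C R V_def orth] using C by simp
  have "(transpose_mat V *\<^sub>v y) $ 0 = (a \<bullet> y) / c"
    using V V_entry y a by (simp add: scalar_prod_def atLeast0LessThan sum_divide_distrib)
  then have "V *\<^sub>v (transpose_mat V *\<^sub>v y) = ((a \<bullet> y) / c\<^sup>2) \<cdot>\<^sub>v a"
    using V V_entry a
    by (intro eq_vecI) (auto simp: scalar_prod_def power2_eq_square)
  then have "proj_perp (col_mat A j) *\<^sub>v y = y - ((a \<bullet> y) / c\<^sup>2) \<cdot>\<^sub>v a"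
    unfolding P
    using minus_mult_distrib_mat_vec[OF one_carrier_mat mult_carrier_mat[OF V Vt] y]
      assoc_mult_mat_vec[OF V Vt y] y by simp
  then show ?thesis by (simp add: a_def c_def)
qed

context full_column_rank
begin

text \<open>A zero column would have zero projection, but \<open>dir t\<close> has positive
  norm.\<close>

lemma norm2_col_pos:
  assumes t: "t < n"
  shows "0 < norm2 (col A t)"
proof (rule ccontr)
  have a: "col A t \<in> carrier_vec m" using A by auto
  have P: "proj_perp (cols_from A (Suc t)) \<in> carrier_mat m m" using proj_carrier[of "Suc t"] t by simp
  have "0 \<le> col A t \<bullet> col A t" by (simp add: scalar_prod_self_eq_sum sum_nonneg)
  moreover assume "\<not> 0 < norm2 (col A t)"
  ultimately have "col A t \<bullet> col A t = 0" by (simp add: norm2_def)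
  then have "col A t = 0\<^sub>v m" by (rule scalar_prod_self_eq_0[OF a])
  then have "dir t = 0\<^sub>v m" using P by (auto simp: dir_def)
  then show False using norm2_dir_pos[OF t] by (simp add: norm2_def)
qed

text \<open>Projecting off the first column replaces the weight \<open>w $ 0\<close> by the
  least-squares coefficient \<open>z\<close>, and the second projection removes the other columns:
  what remains is the projected \<open>y\<close> minus \<open>z\<close> times \<open>dir 0\<close>.
  The refitted state has the same error with \<open>q\<close> in place of \<open>z\<close>.\<close>

lemma first_error:
  fixes w y :: "real vec" and q :: real
  assumes n: "0 < n" and y: "y \<in> carrier_vec m" and w: "w \<in> carrier_vec n" and i: "i < m"
  defines "z \<equiv> (col A 0 \<bullet> (y - cols_from A 1 *\<^sub>v vec_from w 1)) / (norm2 (col A 0))\<^sup>2"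
  shows "(y - A *\<^sub>v vCons q (pinv (cols_from A 1) *\<^sub>v (y - q \<cdot>\<^sub>v col A 0))) $ i
    = (proj_perp (cols_from A 1) *\<^sub>v (proj_perp (col_mat A 0) *\<^sub>v (y - A *\<^sub>v w))) $ i
      + (z - q) * dir 0 $ i"
proof -
  define a B P where "a = col A 0" and "B = cols_from A 1" and "P = proj_perp B"
  have n1: "1 \<le> n" using n by simp
  have a: "a \<in> carrier_vec m" using A by (auto simp: a_def)
  note B = cols_from_carrier[of 1, folded B_def] and Pc = proj_carrier[OF n1, folded B_def, folded P_def]
  have w': "vec_from w 1 \<in> carrier_vec (n - 1)" using w by (simp add: vec_from_def)
  have split: "A *\<^sub>v v = v $ 0 \<cdot>\<^sub>v a + B *\<^sub>v vec_from v 1" if v: "v \<in> carrier_vec n" for v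
    using mult_mat_vec_split[OF A v n1] A B n by (intro eq_vecI) (auto simp: a_def B_def)
  define x where "x = y - B *\<^sub>v vec_from w 1"
  have x: "x \<in> carrier_vec m" using y B w' by (auto simp: x_def)
  have z: "z = (a \<bullet> x) / (norm2 a)\<^sup>2" by (simp add: z_def x_def a_def B_def)
  have na: "0 < norm2 a" using norm2_col_pos[OF n] by (simp add: a_def)
  have aa: "a \<bullet> a = (norm2 a)\<^sup>2" using scalar_prod_self_eq_sum[of a] by (simp add: norm2_def sum_nonneg)
  have yAw: "y - A *\<^sub>v w = x - w $ 0 \<cdot>\<^sub>v a"
    unfolding split[OF w] x_def using y a B w' by (intro eq_vecI) auto
  have r: "y - A *\<^sub>v w \<in> carrier_vec m" using A by (intro carrier_vecI) simp
  have "a \<bullet> (y - A *\<^sub>v w) = a \<bullet> x - w $ 0 * (norm2 a)\<^sup>2"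
    unfolding yAw using a x by (simp add: scalar_prod_minus_distrib[of _ m] aa)
  then have "(a \<bullet> (y - A *\<^sub>v w)) / (norm2 a)\<^sup>2 = z - w $ 0"
    using na by (simp add: z diff_divide_distrib)
  then have "proj_perp (col_mat A 0) *\<^sub>v (y - A *\<^sub>v w) = (y - A *\<^sub>v w) - (z - w $ 0) \<cdot>\<^sub>v a"
    using proj_perp_col_mat[OF A _ r, of 0] na by (simp add: a_def)
  also have "\<dots> = y - B *\<^sub>v vec_from w 1 - z \<cdot>\<^sub>v a"
    unfolding yAw x_def using y a B w' by (intro eq_vecI) (auto simp: algebra_simps)
  finally have "P *\<^sub>v (proj_perp (col_mat A 0) *\<^sub>v (y - A *\<^sub>v w))
      = P *\<^sub>v (y - B *\<^sub>v vec_from w 1 - z \<cdot>\<^sub>v a)" by simp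
  also have "\<dots> = P *\<^sub>v y - 0\<^sub>v m - z \<cdot>\<^sub>v dir 0"
    using proj_perp_range[OF n1, folded B_def, folded P_def, OF w']
      mult_minus_distrib_mat_vec[OF Pc x[unfolded x_def], of "z \<cdot>\<^sub>v a"]
      mult_minus_distrib_mat_vec[OF Pc y mult_mat_vec_carrier[OF B w']]
      mult_mat_vec[OF Pc a, of z] a
    by (simp add: dir_def a_def B_def P_def)
  finally have R: "P *\<^sub>v (proj_perp (col_mat A 0) *\<^sub>v (y - A *\<^sub>v w)) = P *\<^sub>v y - 0\<^sub>v m - z \<cdot>\<^sub>v dir 0" .
  define u where "u = y - q \<cdot>\<^sub>v a"
  have u: "u \<in> carrier_vec m" using y a by (auto simp: u_def)
  define x' where "x' = pinv B *\<^sub>v u"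
  have p: "x' \<in> carrier_vec (n - 1)"
    unfolding x'_def using pinv_carrier[OF n1] u by (auto simp: B_def)
  have v: "vCons q x' \<in> carrier_vec n" using carrier_vecD[OF p] n by (intro carrier_vecI) simp
  have "vec_from (vCons q x') 1 = x'"
    by (intro eq_vecI) (auto simp: vec_from_def)
  then have "A *\<^sub>v vCons q x' = q \<cdot>\<^sub>v a + B *\<^sub>v x'" using split[OF v] by simp
  \<comment> \<open>The refit by the pseudoinverse leaves exactly the part of \<open>u\<close>
    orthogonal to the remaining columns.\<close>
  then have "y - A *\<^sub>v vCons q x' = u - B *\<^sub>v x'"
    unfolding u_def using y a B p by (intro eq_vecI) auto
  also have "\<dots> = P *\<^sub>v u"
    using proj_perp_apply[OF n1 u] by (simp add: B_def P_def x'_def)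
  also have "\<dots> = P *\<^sub>v y - q \<cdot>\<^sub>v dir 0"
    unfolding u_def using mult_minus_distrib_mat_vec[OF Pc y, of "q \<cdot>\<^sub>v a"] mult_mat_vec[OF Pc a, of q] a
    by (simp add: dir_def a_def B_def P_def)
  finally have "y - A *\<^sub>v vCons q x' = P *\<^sub>v y - q \<cdot>\<^sub>v dir 0" .
  moreover have "dir 0 \<in> carrier_vec m" using Pc a by (simp add: dir_def a_def B_def P_def)
  ultimately show ?thesis
    using R i Pc unfolding a_def B_def P_def u_def x'_def by (simp add: algebra_simps)
qed

text \<open>The whole update subtracts a multiple of \<open>col L t\<close>: triangularity protects
  the entries already rounded, and the multiple is chosen so that entry \<open>t\<close> becomes
  \<open>q\<close>. Multiplication by \<open>A\<close> turns \<open>col L t\<close> into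
  \<open>col U t\<close>, which is parallel to \<open>dir t\<close>.\<close>

lemma step_error:
  fixes v y :: "real vec" and q :: real
  assumes t: "t < n" and y: "y \<in> carrier_vec m" and v: "v \<in> carrier_vec n" and i: "i < m"
  defines "v' \<equiv> vec (dim_vec v) (\<lambda>i. if i < t then v $ i else if i = t then q
    else v $ i - L $$ (i, t) * (v $ t - q) / L $$ (t, t))"
  shows "(y - A *\<^sub>v v') $ i = (y - A *\<^sub>v v) $ i + (v $ t - q) * dir t $ i"
proof -
  define c where "c = (v $ t - q) / L $$ (t, t)"
  have l: "col L t \<in> carrier_vec n" using L by auto
  have "v' = v - c \<cdot>\<^sub>v col L t"
  proof (rule eq_vecI)
    fix j assume "j < dim_vec (v - c \<cdot>\<^sub>v col L t)"
    then have j: "j < n" using L by simp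
    show "v' $ j = (v - c \<cdot>\<^sub>v col L t) $ j"
      using j v l L L_low[of j t] L_pos[OF t] t by (auto simp: v'_def c_def)
  qed (use v L in \<open>auto simp: v'_def\<close>)
  then have "A *\<^sub>v v' = A *\<^sub>v v - c \<cdot>\<^sub>v col U t"
    using mult_minus_distrib_mat_vec[OF A v, of "c \<cdot>\<^sub>v col L t"] mult_mat_vec[OF A l, of c] l
    by (simp add: col_U[OF t])
  then show ?thesis
    using dir_eq[OF t] y A U i by (simp add: c_def)
qed

end

section \<open>Concentration of the rounding error\<close>

text \<open>The nonnegative integral lets the bound be iterated through \<open>bind_pmf\<close>
  without integrability conditions.\<close>

lemma pmf_hoeffding_pos:
  fixes f :: "'a \<Rightarrow> real"
  assumes f: "\<And>x. x \<in> set_pmf M \<Longrightarrow> f x \<in> {a..b}" and mean: "measure_pmf.expectation M f = 0"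
    and s: "0 < s"
  shows "(\<integral>\<^sup>+x. ennreal (exp (s * f x)) \<partial>measure_pmf M) \<le> ennreal (exp (s\<^sup>2 * (b - a)\<^sup>2 / 8))"
proof -
  interpret interval_bounded_random_variable "measure_pmf M" f a b
    by unfold_locales (use f in \<open>auto simp: AE_measure_pmf_iff\<close>)
  show ?thesis by (rule Hoeffdings_lemma_nn_integral_0[OF s mean])
qed

text \<open>Negative \<open>s\<close> reduces to positive \<open>s\<close> by passing to
  \<open>- f\<close>, whose range lies in an interval of the same length. Both signs matter because
  \<open>s\<close> is later scaled by coordinates of \<open>dir t\<close>, which may be negative or
  zero.\<close>

lemma pmf_hoeffding:
  fixes f :: "'a \<Rightarrow> real"
  assumes f: "\<And>x. x \<in> set_pmf M \<Longrightarrow> f x \<in> {a..b}" and mean: "measure_pmf.expectation M f = 0"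
  shows "(\<integral>\<^sup>+x. ennreal (exp (s * f x)) \<partial>measure_pmf M) \<le> ennreal (exp (s\<^sup>2 * (b - a)\<^sup>2 / 8))"
proof (cases s "0 :: real" rule: linorder_cases)
  case less
  have "(\<integral>\<^sup>+x. ennreal (exp ((- s) * (- f x))) \<partial>measure_pmf M)
      \<le> ennreal (exp ((- s)\<^sup>2 * ((- a) - (- b))\<^sup>2 / 8))"
    by (rule pmf_hoeffding_pos) (use f mean less in auto)
  also have "(- a - - b)\<^sup>2 = (b - a)\<^sup>2" by simp
  finally show ?thesis by simp
next
  case equal
  then show ?thesis by (simp add: measure_pmf.emeasure_space_1[simplified])
next
  case greater
  then show ?thesis by (intro pmf_hoeffding_pos f mean)
qed

lemma q_stoc_mgf:
  assumes \<delta>: "0 < \<delta>"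
  shows "(\<integral>\<^sup>+q. ennreal (exp (s * (z - q))) \<partial>measure_pmf (q_stoc \<delta> z)) \<le> ennreal (exp (s\<^sup>2 * \<delta>\<^sup>2 / 8))"
proof -
  define k where "k = real_of_int \<lfloor>z / \<delta>\<rfloor>"
  \<comment> \<open>The probability of rounding down is the distance from \<open>z\<close> to the
    upper grid point in units of \<delta>; this centres the error, whose two values are \<delta>
    apart.\<close>
  define \<theta> where "\<theta> = 1 - z / \<delta> + k"
  have \<theta>: "0 \<le> \<theta>" "\<theta> \<le> 1" unfolding \<theta>_def k_def by linarith+
  have q: "q_stoc \<delta> z = map_pmf (\<lambda>b. if b then k * \<delta> else (k + 1) * \<delta>) (bernoulli_pmf \<theta>)"
    by (simp only: q_stoc_def k_def \<theta>_def)
  have "measure_pmf.expectation (q_stoc \<delta> z) (\<lambda>q. z - q)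
      = (z - k * \<delta>) * \<theta> + (z - (k + 1) * \<delta>) * (1 - \<theta>)"
    unfolding q using \<theta> by simp
  also have "\<dots> = 0" using \<delta> by (simp add: \<theta>_def field_simps)
  finally have mean: "measure_pmf.expectation (q_stoc \<delta> z) (\<lambda>q. z - q) = 0" .
  have "(\<integral>\<^sup>+q. ennreal (exp (s * (z - q))) \<partial>measure_pmf (q_stoc \<delta> z))
      \<le> ennreal (exp (s\<^sup>2 * ((z - k * \<delta>) - (z - (k + 1) * \<delta>))\<^sup>2 / 8))"
    by (rule pmf_hoeffding[OF _ mean]) (use \<delta> in \<open>auto simp: q algebra_simps split: if_splits\<close>)
  also have "(z - k * \<delta>) - (z - (k + 1) * \<delta>) = \<delta>" by (simp add: algebra_simps)
  finally show ?thesis .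
qed

lemma pmf_chernoff:
  fixes f :: "'a \<Rightarrow> real"
  assumes mgf: "\<And>s. (\<integral>\<^sup>+x. ennreal (exp (s * f x)) \<partial>measure_pmf M) \<le> ennreal (exp (s\<^sup>2 * c / 8))"
    and c: "0 < c" and a: "0 < a"
  shows "measure_pmf.prob M {x. a \<le> f x} \<le> exp (- (2 * a\<^sup>2 / c))"
proof -
  \<comment> \<open>This choice minimizes the exponent \<open>- s * a + s\<^sup>2 * c / 8\<close>;
    the minimum is \<open>- (2 * a\<^sup>2 / c)\<close>.\<close>
  define s where "s = 4 * a / c"
  have s: "0 < s" using a c by (simp add: s_def)
  have "emeasure (measure_pmf M) {x. a \<le> f x}
      \<le> emeasure (measure_pmf M) {x. 1 \<le> ennreal (exp (- s * a)) * ennreal (exp (s * f x))}"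
    using s by (intro emeasure_mono)
      (auto simp: ennreal_mult[symmetric] exp_add[symmetric] ennreal_1[symmetric] simp del: ennreal_1)
  also have "\<dots> \<le> ennreal (exp (- s * a)) * (\<integral>\<^sup>+x. ennreal (exp (s * f x)) \<partial>measure_pmf M)"
    using nn_integral_Markov_inequality[of "\<lambda>x. ennreal (exp (s * f x))" "UNIV" "measure_pmf M" "ennreal (exp (- s * a))"]
    by simp
  also have "\<dots> \<le> ennreal (exp (- s * a)) * ennreal (exp (s\<^sup>2 * c / 8))"
    by (intro mult_left_mono mgf) auto
  also have "\<dots> = ennreal (exp (- s * a + s\<^sup>2 * c / 8))"
    by (simp add: ennreal_mult[symmetric] exp_add[symmetric])
  also have "- s * a + s\<^sup>2 * c / 8 = - (2 * a\<^sup>2 / c)"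
    using c by (simp add: s_def field_simps power2_eq_square)
  finally show ?thesis
    by (simp add: measure_pmf.emeasure_eq_measure)
qed

lemma pmf_chernoff_abs:
  fixes f :: "'a \<Rightarrow> real"
  assumes mgf: "\<And>s. (\<integral>\<^sup>+x. ennreal (exp (s * f x)) \<partial>measure_pmf M) \<le> ennreal (exp (s\<^sup>2 * c / 8))"
    and c: "0 < c" and a: "0 < a"
  shows "measure_pmf.prob M {x. a < \<bar>f x\<bar>} \<le> 2 * exp (- (2 * a\<^sup>2 / c))"
proof -
  have mgf': "(\<integral>\<^sup>+x. ennreal (exp (s * - f x)) \<partial>measure_pmf M) \<le> ennreal (exp (s\<^sup>2 * c / 8))" for s
    using mgf[of "- s"] by simp
  have "measure_pmf.prob M {x. a < \<bar>f x\<bar>} \<le> measure_pmf.prob M ({x. a \<le> f x} \<union> {x. a \<le> - f x})"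
    by (intro measure_pmf.finite_measure_mono) auto
  also have "\<dots> \<le> measure_pmf.prob M {x. a \<le> f x} + measure_pmf.prob M {x. a \<le> - f x}"
    by (intro measure_Un_le) auto
  also have "\<dots> \<le> 2 * exp (- (2 * a\<^sup>2 / c))"
    using pmf_chernoff[OF mgf c a] pmf_chernoff[OF mgf' c a] by simp
  finally show ?thesis .
qed

section \<open>Moment generating function and tails of the Qronos error\<close>

context full_column_rank
begin

text \<open>Restricts the inductive step below to states of the right dimension, as
  \<open>step_error\<close> demands.\<close>

lemma qronos_state_carrier:
  assumes n: "0 < n" and v: "v \<in> set_pmf (qronos_state \<delta> X A w k)"
  shows "v \<in> carrier_vec n"
  using v
proof (induction k arbitrary: v)
  case 0
  have "dim_row (pinv (cols_from A 1)) = n - 1"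
    using pinv_carrier[of 1] n by simp
  then show ?case using 0 n by (auto simp: qronos_first_def intro!: carrier_vecI)
next
  case (Suc k)
  then show ?case by (auto simp: qronos_step_def intro!: carrier_vecI) 
qed

text \<open>A martingale argument carried out by iterated integration: given the state, a fresh call
  of the quantizer contributes a factor bounded independently of that state, so the exponents of all
  steps add up.\<close>

lemma qronos_state_mgf:
  fixes X :: "real mat" and w :: "real vec"
  assumes \<delta>: "0 < \<delta>" and y: "X *\<^sub>v w \<in> carrier_vec m" and w: "w \<in> carrier_vec n"
    and i: "i < m" and k: "k < n"
  defines "b \<equiv> (proj_perp (cols_from A 1) *\<^sub>v (proj_perp (col_mat A 0) *\<^sub>v (X *\<^sub>v w - A *\<^sub>v w))) $ i"
  shows "(\<integral>\<^sup>+v. ennreal (exp (s * ((X *\<^sub>v w - A *\<^sub>v v) $ i - b))) \<partial>measure_pmf (qronos_state \<delta> X A w k))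
    \<le> ennreal (exp (s\<^sup>2 * (\<delta>\<^sup>2 * (\<Sum>t<Suc k. (dir t $ i)\<^sup>2)) / 8))"
  using k
proof (induction k)
  case 0
  define z where "z = (col A 0 \<bullet> (X *\<^sub>v w - cols_from A 1 *\<^sub>v vec_from w 1)) / (norm2 (col A 0))\<^sup>2"
  have n: "0 < n" using 0 by simp
  have err: "(X *\<^sub>v w - A *\<^sub>v vCons q (pinv (cols_from A 1) *\<^sub>v (X *\<^sub>v w - q \<cdot>\<^sub>v col A 0))) $ i
      = b + (z - q) * dir 0 $ i" for q
    unfolding b_def z_def by (rule first_error[OF n y w i])
  have "(\<integral>\<^sup>+v. ennreal (exp (s * ((X *\<^sub>v w - A *\<^sub>v v) $ i - b))) \<partial>measure_pmf (qronos_state \<delta> X A w 0))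
      = (\<integral>\<^sup>+q. ennreal (exp ((s * dir 0 $ i) * (z - q))) \<partial>measure_pmf (q_stoc \<delta> z))"
    unfolding qronos_state.simps qronos_first_def nn_integral_bind_pmf z_def[symmetric]
    by (simp add: err[unfolded One_nat_def] mult_ac)
  also have "\<dots> \<le> ennreal (exp ((s * dir 0 $ i)\<^sup>2 * \<delta>\<^sup>2 / 8))" by (rule q_stoc_mgf[OF \<delta>])
  finally show ?case by (simp add: power_mult_distrib mult_ac)
next
  case (Suc k)
  define c where "c = dir (Suc k) $ i"
  define f where "f v = (X *\<^sub>v w - A *\<^sub>v v) $ i - b" for v
  have n: "0 < n" using Suc by simp
  have "(\<integral>\<^sup>+v'. ennreal (exp (s * f v')) \<partial>measure_pmf (qronos_step \<delta> L (Suc k) v))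
      \<le> ennreal (exp (s * f v)) * ennreal (exp (s\<^sup>2 * (\<delta>\<^sup>2 * c\<^sup>2) / 8))"
    if v: "v \<in> carrier_vec n" for v
  proof -
    have "(\<integral>\<^sup>+v'. ennreal (exp (s * f v')) \<partial>measure_pmf (qronos_step \<delta> L (Suc k) v))
        = (\<integral>\<^sup>+q. ennreal (exp (s * f v)) * ennreal (exp ((s * c) * (v $ Suc k - q)))
            \<partial>measure_pmf (q_stoc \<delta> (v $ Suc k)))"
      unfolding qronos_step_def nn_integral_bind_pmf f_def c_def
      by (simp add: step_error[OF Suc.prems y v i] ennreal_mult[symmetric] exp_add[symmetric] algebra_simps)
    also have "\<dots> = ennreal (exp (s * f v))
        * (\<integral>\<^sup>+q. ennreal (exp ((s * c) * (v $ Suc k - q))) \<partial>measure_pmf (q_stoc \<delta> (v $ Suc k)))"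
      by (rule nn_integral_cmult) simp
    also have "\<dots> \<le> ennreal (exp (s * f v)) * ennreal (exp ((s * c)\<^sup>2 * \<delta>\<^sup>2 / 8))"
      by (intro mult_left_mono q_stoc_mgf \<delta>) simp
    finally show ?thesis by (simp add: power_mult_distrib mult_ac)
  qed
  \<comment> \<open>The factor for the new step does not depend on \<open>v\<close>, so it can be
    taken out of the integral over the earlier states before the induction hypothesis is
    used.\<close>
  then have "(\<integral>\<^sup>+v. ennreal (exp (s * f v)) \<partial>measure_pmf (qronos_state \<delta> X A w (Suc k)))
      \<le> (\<integral>\<^sup>+v. ennreal (exp (s * f v)) * ennreal (exp (s\<^sup>2 * (\<delta>\<^sup>2 * c\<^sup>2) / 8))
          \<partial>measure_pmf (qronos_state \<delta> X A w k))"
    unfolding qronos_state.simps L_def[symmetric] nn_integral_bind_pmf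
    by (intro nn_integral_mono_AE) (auto simp: AE_measure_pmf_iff qronos_state_carrier[OF n])
  also have "\<dots> = (\<integral>\<^sup>+v. ennreal (exp (s * f v)) \<partial>measure_pmf (qronos_state \<delta> X A w k))
      * ennreal (exp (s\<^sup>2 * (\<delta>\<^sup>2 * c\<^sup>2) / 8))"
    by (rule nn_integral_multc) simp
  also have "\<dots> \<le> ennreal (exp (s\<^sup>2 * (\<delta>\<^sup>2 * (\<Sum>t<Suc k. (dir t $ i)\<^sup>2)) / 8))
      * ennreal (exp (s\<^sup>2 * (\<delta>\<^sup>2 * c\<^sup>2) / 8))"
    using Suc unfolding f_def by (intro mult_right_mono) auto
  also have "\<dots> = ennreal (exp (s\<^sup>2 * (\<delta>\<^sup>2 * (\<Sum>t<Suc (Suc k). (dir t $ i)\<^sup>2)) / 8))"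
    by (simp add: ennreal_mult[symmetric] exp_add[symmetric] c_def algebra_simps add_divide_distrib)
  finally show ?case unfolding f_def .
qed

text \<open>The final state has index \<open>n - 1\<close>, so all \<open>n\<close> directions enter
  and their sum of squares is at most \<open>G\<^sup>2\<close>. The threshold is \<open>r\<close>
  times \<open>\<delta> * G\<close>, hence \<delta> and \<open>G\<close> cancel in the
  exponent.\<close>

lemma qronos_coordinate_tail:
  fixes X :: "real mat" and w :: "real vec"
  assumes n: "0 < n" and \<delta>: "0 < \<delta>" and y: "X *\<^sub>v w \<in> carrier_vec m" and w: "w \<in> carrier_vec n"
    and i: "i < m" and G: "\<And>t. t < n \<Longrightarrow> norm2 (dir t) \<le> G" and r: "0 < r"
  defines "b \<equiv> (proj_perp (cols_from A 1) *\<^sub>v (proj_perp (col_mat A 0) *\<^sub>v (X *\<^sub>v w - A *\<^sub>v w))) $ i"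
  shows "measure_pmf.prob (qronos \<delta> X A w) {v. \<delta> * r * G < \<bar>(X *\<^sub>v w - A *\<^sub>v v) $ i - b\<bar>}
    \<le> 2 * exp (- (2 * r\<^sup>2))"
proof -
  have G0: "0 < G" using norm2_dir_pos[OF n] G[OF n] by simp
  have q: "qronos \<delta> X A w = qronos_state \<delta> X A w (n - 1)" using A by (simp add: qronos_def)
  have "(\<integral>\<^sup>+v. ennreal (exp (s * ((X *\<^sub>v w - A *\<^sub>v v) $ i - b))) \<partial>measure_pmf (qronos \<delta> X A w))
    \<le> ennreal (exp (s\<^sup>2 * (\<delta>\<^sup>2 * G\<^sup>2) / 8))" for s
  proof -
    have "(\<integral>\<^sup>+v. ennreal (exp (s * ((X *\<^sub>v w - A *\<^sub>v v) $ i - b))) \<partial>measure_pmf (qronos \<delta> X A w))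
      \<le> ennreal (exp (s\<^sup>2 * (\<delta>\<^sup>2 * (\<Sum>t<n. (dir t $ i)\<^sup>2)) / 8))"
      using qronos_state_mgf[OF \<delta> y w i, of "n - 1" s] n unfolding q b_def by simp
    also have "\<dots> \<le> ennreal (exp (s\<^sup>2 * (\<delta>\<^sup>2 * G\<^sup>2) / 8))"
      using sum_dir_sq_le[OF i G] by (intro ennreal_leI) (auto intro!: mult_left_mono)
    finally show ?thesis .
  qed
  from pmf_chernoff_abs[OF this, of "\<delta> * r * G"] show ?thesis
    using \<delta> r G0 by (simp add: power_mult_distrib)
qed

end

section \<open>Numerical estimate and union bound\<close>

text \<open>With \<open>x = N powr p\<close> the left side is \<open>2 * x powr (- 4 * pi)\<close>.
  After taking logarithms it suffices that \<open>ln 2 / 2\<close> is less than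
  \<open>(4 * pi - 1) * ln x\<close>, which follows from \<open>ln 2 / 2 \<le> ln x\<close>,
  positivity of \<open>ln x\<close> and \<open>pi > 3\<close>.\<close>

lemma powr_tail_bound:
  fixes N p M :: real
  assumes N: "1 < N" and p: "0 < p" and M: "1 \<le> M" and large: "sqrt 2 * M \<le> N powr p"
  shows "2 * exp (- (2 * (sqrt (2 * pi * p * ln N))\<^sup>2)) < sqrt 2 / N powr p"
proof -
  define x where "x = N powr p"
  have x0: "0 < x" using N by (simp add: x_def)
  have lnx: "ln x = p * ln N" using N by (simp add: x_def ln_powr)
  have "sqrt 2 \<le> x" using large M by (smt (verit) mult_le_cancel_left1 real_sqrt_gt_zero x_def)
  then have ln2: "ln 2 / 2 \<le> ln x"
    using x0 ln_mono[of "sqrt 2" x] by (simp add: ln_sqrt)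
  have sq: "(sqrt (2 * pi * p * ln N))\<^sup>2 = 2 * pi * ln x"
    using N p by (simp add: lnx)
  have "0 < ln x" using N p by (simp add: lnx)
  then have "3 * ln x < pi * ln x" using pi_gt3 by simp
  moreover have "2 * (2 * pi * ln x) = 4 * (pi * ln x)" by simp
  ultimately have "ln 2 - 2 * (2 * pi * ln x) < ln 2 / 2 - ln x"
    using ln2 \<open>0 < ln x\<close> by linarith
  also have "ln 2 / 2 - ln x = ln (sqrt 2 / x)" using x0 by (simp add: ln_div ln_sqrt)
  finally have "exp (ln 2 - 2 * (2 * pi * ln x)) < exp (ln (sqrt 2 / x))" by simp
  then have "2 * exp (- (2 * (2 * pi * ln x))) < sqrt 2 / x"
    using x0 by (simp add: exp_diff exp_minus divide_inverse)
  then show ?thesis by (simp only: sq x_def)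
qed

theorem theorem5p4:
  fixes X Xt :: "real mat" and w :: "real vec" and \<delta> p :: real and m N :: nat
  assumes "1 \<le> N"
    and "X \<in> carrier_mat m N"
    and "Xt \<in> carrier_mat m N"
    and "vec_space.rank m Xt = N"
    and "w \<in> carrier_vec N"
    and "0 < \<delta>"
    and "0 < p"
  shows "measure_pmf.prob (qronos \<delta> X Xt w)
      {q. (MAX i\<in>{..<m}. \<bar>(X *\<^sub>v w - Xt *\<^sub>v q) $ i\<bar>)
          \<le> (MAX i\<in>{..<m}. \<bar>(proj_perp (cols_from Xt 1) *\<^sub>v
                (proj_perp (col_mat Xt 0) *\<^sub>v (X *\<^sub>v w - Xt *\<^sub>v w))) $ i\<bar>)
            + \<delta> * sqrt (2 * pi * p * ln (real N))
              * (MAX j\<in>{..<N}. norm2 (proj_perp (cols_from Xt (Suc j)) *\<^sub>v col Xt j))}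
    > 1 - sqrt 2 * real m / real N powr p"
    (is "measure_pmf.prob ?M ?E > _")
proof (cases "sqrt 2 * real m \<le> real N powr p")
  case False
  then have "1 < sqrt 2 * real m / real N powr p" using assms(1) by (simp add: less_divide_eq)
  then show ?thesis using measure_nonneg[of "measure_pmf ?M" ?E] by linarith
next
  case True
  interpret full_column_rank Xt m N
    "cholesky_factor (the (mat_inverse (transpose_mat Xt * Xt)))"
    "Xt * cholesky_factor (the (mat_inverse (transpose_mat Xt * Xt)))"
    by unfold_locales (use assms(3) full_rank_imp_injective[OF assms(3,4)] in auto)
  have y: "X *\<^sub>v w \<in> carrier_vec m" using assms(2,5) by simp
  have n: "0 < N" using assms(1) by simp
  \<comment> \<open>A matrix without rows would annihilate a unit vector. Positivity of
    \<open>m\<close> makes the maxima over coordinates range over nonempty sets, and it keeps the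
    final estimate strict.\<close>
  have m: "0 < m"
  proof (rule ccontr)
    assume "\<not> 0 < m"
    then have "Xt *\<^sub>v unit_vec N 0 = 0\<^sub>v m" using assms(3) by (intro eq_vecI) auto
    then have "unit_vec N 0 = (0\<^sub>v N :: real vec)" by (intro inj) auto
    then have "unit_vec N 0 $ 0 = (0\<^sub>v N $ 0 :: real)" by simp
    then show False using n by simp
  qed
  \<comment> \<open>For \<open>N = 1\<close> the power is 1, below \<open>sqrt 2 * real m\<close>.
    Excluding this case gives \<open>ln (real N) > 0\<close>, so the deviation \<open>r\<close> is
    positive.\<close>
  have N1: "1 < real N"
  proof (rule ccontr)
    assume "\<not> 1 < real N"
    then have "N = 1" using assms(1) by simp
    then have "sqrt 2 * real m \<le> 1" using True by simp
    moreover have "1 * 1 < sqrt 2 * real m" using m by (intro mult_less_le_imp_less) auto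
    ultimately show False by simp
  qed
  define G where "G = (MAX j\<in>{..<N}. norm2 (proj_perp (cols_from Xt (Suc j)) *\<^sub>v col Xt j))"
  define r where "r = sqrt (2 * pi * p * ln (real N))"
  define b where "b = proj_perp (cols_from Xt 1) *\<^sub>v (proj_perp (col_mat Xt 0) *\<^sub>v (X *\<^sub>v w - Xt *\<^sub>v w))"
  define T where "T i = {v. \<delta> * r * G < \<bar>(X *\<^sub>v w - Xt *\<^sub>v v) $ i - b $ i\<bar>}" for i
  have r: "0 < r" using N1 assms(7) by (simp add: r_def)
  have G: "norm2 (dir t) \<le> G" if "t < N" for t
    unfolding G_def dir_def using that by (intro Max_ge) auto
  \<comment> \<open>If every coordinate of the error is within \<open>\<delta> * r * G\<close> of
    that of \<open>b\<close>, the triangle inequality yields the bound between the maxima.\<close>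
  have sub: "- ?E \<subseteq> (\<Union>i<m. T i)"
  proof
    fix v assume v: "v \<in> - ?E"
    show "v \<in> (\<Union>i<m. T i)"
    proof (rule ccontr)
      assume "v \<notin> (\<Union>i<m. T i)"
      then have *: "\<bar>(X *\<^sub>v w - Xt *\<^sub>v v) $ i - b $ i\<bar> \<le> \<delta> * r * G" if "i < m" for i
        using that by (auto simp: T_def not_less)
      have "\<bar>(X *\<^sub>v w - Xt *\<^sub>v v) $ i\<bar> \<le> (MAX i\<in>{..<m}. \<bar>b $ i\<bar>) + \<delta> * r * G" if "i < m" for i
      proof -
        have "\<bar>b $ i\<bar> \<le> (MAX i\<in>{..<m}. \<bar>b $ i\<bar>)" using that by (intro Max_ge) auto
        then show ?thesis using *[OF that] by linarith
      qed
      then have "(MAX i\<in>{..<m}. \<bar>(X *\<^sub>v w - Xt *\<^sub>v v) $ i\<bar>) \<le> (MAX i\<in>{..<m}. \<bar>b $ i\<bar>) + \<delta> * r * G"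
        using m by (intro Max.boundedI) auto
      then show False using v by (simp add: b_def r_def G_def)
    qed
  qed
  have "1 - measure_pmf.prob ?M ?E = measure_pmf.prob ?M (- ?E)"
    using measure_pmf.prob_compl[of ?E ?M] by (simp add: Compl_eq_Diff_UNIV)
  also have "\<dots> \<le> measure_pmf.prob ?M (\<Union>i<m. T i)"
    using sub by (intro measure_pmf.finite_measure_mono) auto
  also have "\<dots> \<le> (\<Sum>i<m. measure_pmf.prob ?M (T i))"
    by (intro measure_pmf.finite_measure_subadditive_finite) auto
  also have "\<dots> \<le> (\<Sum>i<m. 2 * exp (- (2 * r\<^sup>2)))"
    unfolding T_def b_def
    using qronos_coordinate_tail[OF n assms(6) y assms(5) _ G r] by (intro sum_mono) simp
  also have "\<dots> = real m * (2 * exp (- (2 * r\<^sup>2)))" by simp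
  also have "\<dots> < real m * (sqrt 2 / real N powr p)"
    using powr_tail_bound[OF N1 assms(7) _ True] m
    unfolding r_def by (intro mult_strict_left_mono) auto
  finally show ?thesis by (simp add: mult.commute)
qed

end
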